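(* Let $q$ be a rational number with $0<q<1$ such that $q \neq 1/n$ for every integer $n \geq 2$, and such that the denominator of $q$ (written in lowest terms) is odd. Then the monoid algebra $\mathbb{Q}[M_q]$ is atomic.
   Context: For a positive rational $q$, the exponentially cyclic Puiseux monoid is the additive submonoid $M_q := \langle q^n : n \in \mathbb{N}_0 \rangle$ of $(\mathbb{Q}_{\geq 0},+)$ generated by the powers $q^0, q^1, q^2, \ldots$. For a commutative ring $R$, the monoid algebra $R[M_q]$ is the ring of all finite expressions $\sum_i r_i x^{m_i}$ with $r_i \in R$ and exponents $m_i \in M_q$, multiplied via $x^{a}x^{b}=x^{a+b}$; it is an integral domain when $R$ is. An integral domain is atomic if every nonzero nonunit element is a finite product of irreducible elements (atoms). *)

theory Defs
  imports Complex_Main "HOL-Library.Poly_Mapping"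
begin

inductive_set puiseux_monoid :: "rat \<Rightarrow> rat set" for q :: rat where
  zero: "0 \<in> puiseux_monoid q"
| gen: "q ^ n \<in> puiseux_monoid q"
| add: "a \<in> puiseux_monoid q \<Longrightarrow> b \<in> puiseux_monoid q \<Longrightarrow> a + b \<in> puiseux_monoid q"

text \<open>The monoid algebra R[M] for M a submonoid of (rat,+), realised as the subring of the
group algebra (finitely supported functions, convolution product) consisting
of the elements whose exponents (support) lie in M.\<close>
definition monoid_algebra :: "rat set \<Rightarrow> (rat \<Rightarrow>\<^sub>0 'r::comm_ring_1) set" where
  "monoid_algebra M = {f. Poly_Mapping.keys f \<subseteq> M}"

definition unit_in :: "'a::comm_ring_1 set \<Rightarrow> 'a \<Rightarrow> bool" where
  "unit_in S u \<longleftrightarrow> u \<in> S \<and> (\<exists>v\<in>S. u * v = 1)"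

definition irreducible_in :: "'a::comm_ring_1 set \<Rightarrow> 'a \<Rightarrow> bool" where
  "irreducible_in S a \<longleftrightarrow> a \<in> S \<and> a \<noteq> 0 \<and> \<not> unit_in S a \<and>
     (\<forall>b\<in>S. \<forall>c\<in>S. a = b * c \<longrightarrow> unit_in S b \<or> unit_in S c)"

definition atomic_domain :: "'a::comm_ring_1 set \<Rightarrow> bool" where
  "atomic_domain S \<longleftrightarrow> (\<forall>a\<in>S. a \<noteq> 0 \<and> \<not> unit_in S a \<longrightarrow>
     (\<exists>xs. xs \<noteq> [] \<and> (\<forall>x\<in>set xs. irreducible_in S x) \<and> a = prod_list xs))"

end

theory Submission
  imports Defs
begin

text \<open>Write q = a/b in lowest terms, with 2 <= a < b. An element of M_q below q^j is a sum of
  powers q^i with i > j, hence lies in a^(j+1) Z[1/b]. For large j the exponents of a given f are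
  pairwise incongruent modulo a^(j+1) Z[1/b], and then a factor of f with all exponents in this
  subgroup must be a monomial. So the non-monomial factors of f have degree bounded below, and
  their number is bounded. The monomial factors are under control because finite subsets of M_q
  have maximal common divisors: after pulling out a suitable monomial, every further
  factorization into nonunits involves only non-monomials.\<close>

abbreviation keys :: "('a \<Rightarrow>\<^sub>0 'b::zero) \<Rightarrow> 'a set"
  where "keys \<equiv> Poly_Mapping.keys"

abbreviation lookup :: "('a \<Rightarrow>\<^sub>0 'b::zero) \<Rightarrow> 'a \<Rightarrow> 'b"
  where "lookup \<equiv> Poly_Mapping.lookup"

abbreviation single :: "'a \<Rightarrow> 'b \<Rightarrow> 'a \<Rightarrow>\<^sub>0 'b::zero"
  where "single \<equiv> Poly_Mapping.single"

section \<open>Group algebras\<close>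

text \<open>In a group, \<open>k = l + r\<close> determines \<open>r\<close>, so the inner sum of
  the convolution collapses to one term.\<close>

lemma lookup_mult_group:
  fixes f g :: "'a::ab_group_add \<Rightarrow>\<^sub>0 'b::semiring_0"
  shows "lookup (f * g) k = (\<Sum>l\<in>keys f. lookup f l * lookup g (k - l))"
proof -
  have "(\<Sum>r. lookup g r when k = l + r) = lookup g (k - l)" for l
  proof -
    have "(\<lambda>r. lookup g r when k = l + r) = (\<lambda>r. lookup g r when r = k - l)"
      by (auto simp: fun_eq_iff when_def algebra_simps)
    then show ?thesis by (simp only: Sum_any_when_equal)
  qed
  then have "lookup (f * g) k = (\<Sum>l. lookup f l * lookup g (k - l))"
    by (simp add: lookup_mult)
  also have "\<dots> = (\<Sum>l\<in>keys f. lookup f l * lookup g (k - l))"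
    by (rule Sum_any.expand_superset) (auto simp: in_keys_iff)
  finally show ?thesis .
qed

lemma lookup_single_mult:
  fixes f :: "'a::ab_group_add \<Rightarrow>\<^sub>0 'b::semiring_0"
  shows "lookup (single m c * f) k = c * lookup f (k - m)"
  by (cases "c = 0") (simp_all add: lookup_mult_group)

text \<open>An exponent with a single decomposition receives a single term of the convolution, so
  nothing can cancel there. The extreme exponents of a product are of this kind.\<close>

lemma lookup_mult_unique:
  fixes f g :: "'a::ab_group_add \<Rightarrow>\<^sub>0 'b::semiring_0"
  assumes "s \<in> keys f"
    and "\<And>x y. x \<in> keys f \<Longrightarrow> y \<in> keys g \<Longrightarrow> x + y = s + t \<Longrightarrow> x = s"
  shows "lookup (f * g) (s + t) = lookup f s * lookup g t"
proof -
  have "lookup (f * g) (s + t)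
      = (\<Sum>l\<in>keys f. if l = s then lookup f s * lookup g t else 0)"
    unfolding lookup_mult_group
  proof (rule sum.cong)
    fix l assume "l \<in> keys f"
    then show "lookup f l * lookup g (s + t - l)
        = (if l = s then lookup f s * lookup g t else 0)"
      using assms(2)[of l "s + t - l"] by (cases "lookup g (s + t - l) = 0") (auto simp: in_keys_iff)
  qed simp
  then show ?thesis using assms(1) by simp
qed

text \<open>Every other pair of exponents has a strictly smaller sum, so the leading coefficients
  multiply, and over an integral domain their product is nonzero.\<close>

lemma Max_keys_mult:
  fixes f g :: "'a::linordered_ab_group_add \<Rightarrow>\<^sub>0 'b::idom"
  assumes "f \<noteq> 0" "g \<noteq> 0"
  shows "Max (keys f) + Max (keys g) \<in> keys (f * g)"
    and "Max (keys (f * g)) = Max (keys f) + Max (keys g)"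
proof -
  let ?s = "Max (keys f)" and ?t = "Max (keys g)"
  have ne: "keys f \<noteq> {}" "keys g \<noteq> {}"
    using assms by simp_all
  then have st: "?s \<in> keys f" "?t \<in> keys g" by simp_all
  have uniq: "x = ?s" if "x \<in> keys f" "y \<in> keys g" "x + y = ?s + ?t" for x y
  proof -
    have "x \<le> ?s" "y \<le> ?t" using that by simp_all
    then show ?thesis using that(3) by (metis add_le_less_mono add_less_le_mono
      order_less_irrefl order.not_eq_order_implies_strict)
  qed
  have "lookup (f * g) (?s + ?t) = lookup f ?s * lookup g ?t"
    by (rule lookup_mult_unique) (use st uniq in auto)
  then show mem: "?s + ?t \<in> keys (f * g)" using st by (simp add: in_keys_iff)
  show "Max (keys (f * g)) = ?s + ?t"
  proof (rule Max_eqI)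
    fix y assume "y \<in> keys (f * g)"
    then obtain u v where "y = u + v" "u \<in> keys f" "v \<in> keys g"
      using keys_mult[of f g] by auto
    then show "y \<le> ?s + ?t" by (simp add: add_mono)
  qed (use mem in auto)
qed

lemma Min_keys_mult:
  fixes f g :: "'a::linordered_ab_group_add \<Rightarrow>\<^sub>0 'b::idom"
  assumes "f \<noteq> 0" "g \<noteq> 0"
  shows "Min (keys f) + Min (keys g) \<in> keys (f * g)"
proof -
  let ?s = "Min (keys f)" and ?t = "Min (keys g)"
  have ne: "keys f \<noteq> {}" "keys g \<noteq> {}"
    using assms by simp_all
  then have st: "?s \<in> keys f" "?t \<in> keys g" by simp_all
  have uniq: "x = ?s" if "x \<in> keys f" "y \<in> keys g" "x + y = ?s + ?t" for x y
  proof -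
    have "?s \<le> x" "?t \<le> y" using that by simp_all
    then show ?thesis using that(3) by (metis add_le_less_mono add_less_le_mono
      order_less_irrefl order.not_eq_order_implies_strict)
  qed
  have "lookup (f * g) (?s + ?t) = lookup f ?s * lookup g ?t"
    by (rule lookup_mult_unique) (use st uniq in auto)
  then show ?thesis using st by (simp add: in_keys_iff)
qed

text \<open>The width \<open>Max - Min\<close> of the exponents is additive under multiplication. It
  vanishes for a monomial product, hence for both factors.\<close>

lemma single_factor:
  fixes f g :: "'a::linordered_ab_group_add \<Rightarrow>\<^sub>0 'b::idom"
  assumes "f * g = single s c" "c \<noteq> 0"
  shows "\<exists>t d. f = single t d"
proof -
  have "f * g \<noteq> 0" using assms by (metis lookup_single_eq lookup_zero)
  then have nz: "f \<noteq> 0" "g \<noteq> 0" by auto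
  then have ne: "keys f \<noteq> {}" "keys g \<noteq> {}"
    by simp_all
  have "keys (f * g) = {s}" using assms by simp
  then have "Max (keys f) + Max (keys g) = Min (keys f) + Min (keys g)"
    using Max_keys_mult(1)[OF nz] Min_keys_mult[OF nz] by simp
  moreover have "Min (keys f) \<le> Max (keys f)" "Min (keys g) \<le> Max (keys g)"
    using ne by simp_all
  ultimately have eq: "Min (keys f) = Max (keys f)"
    by (metis add_le_less_mono add_less_le_mono
      order_less_irrefl order.not_eq_order_implies_strict)
  have "x = Max (keys f)" if "x \<in> keys f" for x
    using Min_le[OF _ that] Max_ge[OF _ that] eq by simp
  then have "f = single (Max (keys f)) (lookup f (Max (keys f)))"
    by (intro poly_mapping_eqI) (auto simp: lookup_single when_def in_keys_iff)
  then show ?thesis by blast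
qed

text \<open>Grading the group algebra by the cosets of K, the factor g is homogeneous, so it divides
  every homogeneous component of the product, and these components are monomials.\<close>
lemma single_factor_of_incongruent_keys:
  fixes g h :: "'a::linordered_ab_group_add \<Rightarrow>\<^sub>0 'b::idom"
  assumes nz: "g * h \<noteq> 0"
    and K: "\<And>x y. x \<in> K \<Longrightarrow> y \<in> K \<Longrightarrow> x + y \<in> K" "\<And>x. x \<in> K \<Longrightarrow> - x \<in> K"
    and g: "keys g \<subseteq> K"
    and sep: "\<And>x y. x \<in> keys (g * h) \<Longrightarrow> y \<in> keys (g * h) \<Longrightarrow> x - y \<in> K \<Longrightarrow> x = y"
  shows "\<exists>t d. g = single t d"
proof -
  obtain s where s: "s \<in> keys (g * h)"
    using nz by (metis all_not_in_conv keys_eq_empty)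
  \<comment> \<open>The function is the component of \<open>h\<close> in the coset
    \<open>s - K\<close>. Its support lies in that of \<open>h\<close>, so it defines an element of
    the group algebra.\<close>
  have "finite {k. (if s - k \<in> K then lookup h k else 0) \<noteq> 0}"
    by (rule finite_subset[of _ "keys h"]) (auto simp: in_keys_iff)
  then have h': "lookup (Abs_poly_mapping (\<lambda>k. if s - k \<in> K then lookup h k else 0)) k
      = (if s - k \<in> K then lookup h k else 0)" for k
    by simp
  define h' where "h' = Abs_poly_mapping (\<lambda>k. if s - k \<in> K then lookup h k else 0)"
  note h' = h'[folded h'_def]
  have coset: "s - (k - l) \<in> K \<longleftrightarrow> s - k \<in> K" if "l \<in> K" for k l
  proof -
    have "s - (k - l) = (s - k) + l" "s - k = (s - (k - l)) + - l" by simp_all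
    then show ?thesis using K that by metis
  qed
  \<comment> \<open>The exponents of \<open>g\<close> lie in \<open>K\<close>, so multiplication by
    \<open>g\<close> preserves cosets and commutes with restriction to one of them.\<close>
  have lookup_gh': "lookup (g * h') k = (if s - k \<in> K then lookup (g * h) k else 0)" for k
    unfolding lookup_mult_group h' using coset g by (auto intro!: sum.cong sum.neutral)
  have "keys g \<noteq> {}" using nz by auto
  then obtain x where "x \<in> K" using g by blast
  then have "0 \<in> K" using K(1)[OF _ K(2)] by fastforce
  \<comment> \<open>By \<open>sep\<close>, \<open>s\<close> is the only exponent of
    \<open>g * h\<close> in its coset.\<close>
  have "g * h' = single s (lookup (g * h) s)"
  proof (rule poly_mapping_eqI)
    fix k
    show "lookup (g * h') k = lookup (single s (lookup (g * h) s)) k"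
    proof (cases "k = s")
      case True
      then show ?thesis using \<open>0 \<in> K\<close> by (simp add: lookup_gh')
    next
      case False
      then have "s - k \<notin> K \<or> lookup (g * h) k = 0"
        using sep[OF s, of k] by (auto simp: in_keys_iff)
      then show ?thesis using False by (auto simp: lookup_gh' lookup_single)
    qed
  qed
  then show ?thesis using single_factor s by (metis in_keys_iff)
qed

section \<open>The monoid\<close>

locale exponential_puiseux =
  fixes a b :: int and q :: rat
  assumes q: "q = of_int a / of_int b"
    and coprime: "coprime a b"
    and a2: "2 \<le> a"
    and a_less_b: "a < b"
begin

abbreviation M :: "rat set" where "M \<equiv> puiseux_monoid q"

lemma b_nz: "of_int b \<noteq> (0::rat)" using a2 a_less_b by simp

lemma q_pos: "0 < q" using q a2 a_less_b by simp

lemma q_less_1: "q < 1" using q a2 a_less_b by simp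

lemma bq: "of_int b * q = of_int a" using q b_nz by simp

lemma q_pow_mult: "q ^ n * of_int b ^ n = of_int a ^ n"
  using bq by (metis mult.commute power_mult_distrib)

lemma M_nonneg: "x \<in> M \<Longrightarrow> 0 \<le> x"
  by (induction rule: puiseux_monoid.induct) (use q_pos in auto)

lemma M_of_nat_mult: "x \<in> M \<Longrightarrow> of_nat n * x \<in> M"
  by (induction n) (auto simp: algebra_simps intro: puiseux_monoid.intros)

lemma M_sum: "(\<Sum>j\<le>(K::nat). of_nat (c j) * q ^ j) \<in> M"
proof (induction K)
  case 0
  show ?case using M_of_nat_mult[OF puiseux_monoid.gen[of q 0]] by simp
next
  case (Suc K)
  then show ?case
    using puiseux_monoid.add[OF Suc M_of_nat_mult[OF puiseux_monoid.gen[of q "Suc K"]]] by simp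
qed

lemma M_sum_rep: "x \<in> M \<Longrightarrow> \<exists>K c. x = (\<Sum>j\<le>(K::nat). of_nat (c j) * q ^ j)"
proof (induction rule: puiseux_monoid.induct)
  case zero
  show ?case by (rule exI[of _ 0], rule exI[of _ "\<lambda>_. 0"]) simp
next
  case (gen n)
  have "(\<Sum>j\<le>n. of_nat (if j = n then 1 else 0) * q ^ j) = (\<Sum>j\<le>n. if j = n then q ^ j else 0)"
    by (rule sum.cong) auto
  then show ?case by (intro exI[of _ n] exI[of _ "\<lambda>j. if j = n then 1 else 0"]) simp
next
  case (add x y)
  then obtain K c L d where x: "x = (\<Sum>j\<le>(K::nat). of_nat (c j) * q ^ j)"
    and y: "y = (\<Sum>j\<le>(L::nat). of_nat (d j) * q ^ j)" by blast
  have pad: "(\<Sum>j\<le>K. of_nat (c j) * q ^ j)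
      = (\<Sum>j\<le>max K L. of_nat (if j \<le> K then c j else 0) * q ^ j)" for K L c
    by (rule sum.mono_neutral_cong_left) auto
  have "x + y = (\<Sum>j\<le>max K L. of_nat ((if j \<le> K then c j else 0) + (if j \<le> L then d j else 0)) * q ^ j)"
    unfolding x y pad[of c K L] pad[of d L K] max.commute[of L K] sum.distrib[symmetric]
    by (rule sum.cong) (auto simp: algebra_simps)
  then show ?case by (intro exI)
qed

section \<open>Denominators and common divisors in M\<close>

lemma Ints_mult_b: "x * of_int b ^ i \<in> \<int> \<Longrightarrow> i \<le> j \<Longrightarrow> x * of_int b ^ j \<in> \<int>" for x :: rat
proof -
  assume "x * of_int b ^ i \<in> \<int>" "i \<le> j"
  moreover have "x * of_int b ^ j = (x * of_int b ^ i) * of_int (b ^ (j - i))"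
    using \<open>i \<le> j\<close> by (simp add: mult.assoc flip: power_add)
  ultimately show ?thesis by (metis Ints_mult Ints_of_int)
qed

lemma q_pow_Ints: "q ^ i * of_int b ^ i \<in> \<int>"
  unfolding q_pow_mult by simp

lemma M_denominator: "x \<in> M \<Longrightarrow> \<exists>i. x * of_int b ^ i \<in> \<int>"
proof (induction rule: puiseux_monoid.induct)
  case (gen n)
  then show ?case using q_pow_Ints by blast
next
  case (add x y)
  then obtain i j where "x * of_int b ^ i \<in> \<int>" "y * of_int b ^ j \<in> \<int>" by blast
  then have "x * of_int b ^ max i j \<in> \<int>" "y * of_int b ^ max i j \<in> \<int>"
    by (auto intro: Ints_mult_b)
  then show ?case by (metis distrib_right Ints_add)
qed auto

lemma M_common_denominator:
  "finite A \<Longrightarrow> A \<subseteq> M \<Longrightarrow> \<exists>i. \<forall>x\<in>A. x * of_int b ^ i \<in> \<int>"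
proof (induction A rule: finite_induct)
  case (insert x A)
  then obtain i j where "\<forall>x\<in>A. x * of_int b ^ i \<in> \<int>" "x * of_int b ^ j \<in> \<int>"
    using M_denominator[of x] by auto
  then have "\<forall>x\<in>insert x A. x * of_int b ^ max i j \<in> \<int>"
    by (auto intro: Ints_mult_b)
  then show ?case by blast
qed auto

text \<open>A nonzero sum has a nonzero summand, and a generator split off from the summand is split
  off from the sum.\<close>

lemma M_diff_gen: "x \<in> M \<Longrightarrow> x \<noteq> 0 \<Longrightarrow> \<exists>k. x - q ^ k \<in> M"
proof (induction rule: puiseux_monoid.induct)
  case (gen n)
  have "q ^ n - q ^ n \<in> M" by (simp add: puiseux_monoid.zero)
  then show ?case by blast
next
  case (add x y)
  show ?case
  proof (cases "x = 0")
    case True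
    then show ?thesis using add by simp
  next
    case False
    then obtain k where "x - q ^ k \<in> M" using add by blast
    then have "(x - q ^ k) + y \<in> M" using add by (blast intro: puiseux_monoid.add)
    then have "x + y - q ^ k \<in> M" by (simp add: algebra_simps)
    then show ?thesis by blast
  qed
qed auto

text \<open>If the top index of a factorization exceeds i, then b divides its top coefficient, and
  the trade b q^(K+1) = a q^K lowers that index.\<close>
lemma sum_diff_gen:
  assumes "i \<le> K" "\<exists>j\<ge>i. j \<le> K \<and> c j \<noteq> 0"
    "(\<Sum>j\<le>K. of_nat (c j) * q ^ j) * of_int b ^ i \<in> \<int>"
  shows "(\<Sum>j\<le>K. of_nat (c j) * q ^ j) - q ^ i \<in> M"
  using assms
proof (induction K arbitrary: c rule: dec_induct)
  case base
  then have "c i \<noteq> 0" by auto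
  have "(\<Sum>j\<le>i. of_nat (c j) * q ^ j)
      = (\<Sum>j\<le>i. of_nat ((c(i := c i - 1)) j) * q ^ j) + q ^ i"
  proof (cases i)
    case 0
    then show ?thesis using \<open>c i \<noteq> 0\<close> by (simp add: of_nat_diff)
  next
    case (Suc l)
    then show ?thesis using \<open>c i \<noteq> 0\<close> by (simp add: of_nat_diff algebra_simps)
  qed
  then show ?case using M_sum[of "c(i := c i - 1)" i] by simp
next
  case (step K)
  let ?S = "\<lambda>c K. \<Sum>j\<le>K. of_nat (c j) * q ^ j"
  \<comment> \<open>Multiplied by \<open>b ^ K\<close>, both the whole sum and its part up to
    \<open>K\<close> become integers, hence so does the top term. This makes \<open>b\<close> divide
    \<open>c (Suc K) * a ^ Suc K\<close>.\<close>
  have "?S c (Suc K) * of_int b ^ K \<in> \<int>"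
    using step by (intro Ints_mult_b[of _ i K]) auto
  moreover have "?S c K * of_int b ^ K \<in> \<int>"
    unfolding sum_distrib_right
  proof (rule Ints_sum)
    fix j assume "j \<in> {..K}"
    then have "q ^ j * of_int b ^ K \<in> \<int>" using Ints_mult_b q_pow_Ints by auto
    then show "of_nat (c j) * q ^ j * of_int b ^ K \<in> \<int>"
      by (metis Ints_mult Ints_of_nat mult.assoc)
  qed
  ultimately obtain z w where zw: "?S c (Suc K) * of_int b ^ K = of_int z"
    "?S c K * of_int b ^ K = of_int w" by (auto elim!: Ints_cases)
  have "of_nat (c (Suc K)) * of_int a ^ Suc K
      = of_int b * (of_nat (c (Suc K)) * q ^ Suc K * of_int b ^ K)"
    using q_pow_mult[of "Suc K"] by (simp add: mult_ac)
  also have "of_nat (c (Suc K)) * q ^ Suc K * of_int b ^ K = of_int (z - w)"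
    using zw by (simp add: algebra_simps)
  finally have "of_int (int (c (Suc K)) * a ^ Suc K) = (of_int (b * (z - w)) :: rat)"
    by simp
  then have "int (c (Suc K)) * a ^ Suc K = b * (z - w)" by (simp only: of_int_eq_iff)
  then have "b dvd int (c (Suc K))"
    using coprime by (metis coprime_commute coprime_dvd_mult_left_iff coprime_power_right_iff dvd_triv_left)
  then obtain r where "int (c (Suc K)) = b * r" by blast
  moreover have "0 \<le> r" using calculation a2 a_less_b
    by (metis of_nat_0_le_iff zero_le_mult_iff not_le order.strict_trans2 zero_less_numeral less_trans)
  ultimately have "int (c (Suc K)) = b * int (nat r)" by simp
  then obtain m where m: "int (c (Suc K)) = b * int m" by blast
  define d where "d = c(K := c K + nat a * m)"
  have "of_nat (c (Suc K)) = (of_int b * of_nat m :: rat)"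
    using m by (metis of_int_mult of_int_of_nat_eq)
  then have "of_nat (c (Suc K)) * q ^ Suc K = of_nat (nat a * m) * q ^ K"
    using bq a2 by (simp add: mult_ac) 
  moreover have "?S d K = ?S c K + of_nat (nat a * m) * q ^ K"
    by (cases K) (simp_all add: d_def algebra_simps)
  ultimately have eq: "?S c (Suc K) = ?S d K" by simp
  \<comment> \<open>A nonzero coefficient at an index from \<open>i\<close> on survives the trade:
    if it sits at \<open>Suc K\<close>, then \<open>m\<close> is nonzero, and so is
    \<open>d K\<close>.\<close>
  have "\<exists>j\<ge>i. j \<le> K \<and> d j \<noteq> 0"
  proof (cases "c (Suc K) = 0")
    case True
    then obtain j where ij: "i \<le> j" "j \<le> K" and "c j \<noteq> 0"
      using step.prems(1) le_Suc_eq by metis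
    moreover have "c j \<le> d j" by (simp add: d_def)
    ultimately have "d j \<noteq> 0" by simp
    then show ?thesis using ij by blast
  next
    case False
    then have "m \<noteq> 0" using m by (cases m) auto
    then have "d K \<noteq> 0" using a2 by (simp add: d_def)
    then show ?thesis using step.hyps by blast
  qed
  then show ?case using step.IH[of d] step.prems(2) unfolding eq by blast
qed

text \<open>Adding one copy of \<open>q ^ k\<close> to a representation of \<open>x - q ^ k\<close>
  gives a representation of \<open>x\<close> with a nonzero coefficient at \<open>k \<ge> i\<close>,
  to which \<open>sum_diff_gen\<close> applies.\<close>

lemma M_diff_gen_mono:
  assumes "x - q ^ k \<in> M" "i \<le> k" "x * of_int b ^ i \<in> \<int>"
  shows "x - q ^ i \<in> M"
proof -
  obtain K c where c: "x - q ^ k = (\<Sum>j\<le>(K::nat). of_nat (c j) * q ^ j)"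
    using M_sum_rep assms(1) by blast
  define d where "d j = (if j \<le> K then c j else 0) + (if j = k then 1 else 0)" for j
  have "(\<Sum>j\<le>max K k. of_nat (d j) * q ^ j)
      = (\<Sum>j\<le>max K k. of_nat (if j \<le> K then c j else 0) * q ^ j)
      + (\<Sum>j\<le>max K k. if j = k then q ^ j else 0)"
    unfolding sum.distrib[symmetric] by (rule sum.cong) (auto simp: d_def algebra_simps)
  also have "(\<Sum>j\<le>max K k. of_nat (if j \<le> K then c j else 0) * q ^ j) = x - q ^ k"
    unfolding c by (rule sum.mono_neutral_cong_right) auto
  also have "(\<Sum>j\<le>max K k. if j = k then q ^ j else 0) = q ^ k" by simp
  finally have x: "x = (\<Sum>j\<le>max K k. of_nat (d j) * q ^ j)" by simp
  have "d k \<noteq> 0" by (simp add: d_def)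
  then have "\<exists>j\<ge>i. j \<le> max K k \<and> d j \<noteq> 0" using assms(2) by (metis max.cobounded2)
  then show ?thesis using sum_diff_gen[of i "max K k" d] assms x by simp
qed

text \<open>The largest common divisor whose denominator divides that of A is a maximal common
  divisor: by the previous lemma, a further divisor could be chosen with the same denominator.\<close>
lemma maximal_common_divisor:
  assumes "finite A" "A \<noteq> {}" "A \<subseteq> M"
  obtains d where "d \<in> M" "\<And>x. x \<in> A \<Longrightarrow> x - d \<in> M"
    "\<And>e. e \<in> M \<Longrightarrow> (\<And>x. x \<in> A \<Longrightarrow> x - d - e \<in> M) \<Longrightarrow> e = 0"
proof -
  obtain i where i: "\<And>x. x \<in> A \<Longrightarrow> x * of_int b ^ i \<in> \<int>"
    using M_common_denominator[OF assms(1,3)] by auto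
  obtain y where y: "y \<in> A" using assms by blast
  define D where "D = {d \<in> M. d * of_int b ^ i \<in> \<int> \<and> (\<forall>x\<in>A. x - d \<in> M)}"
  have bpos: "0 < (of_int b ^ i :: rat)" using a2 a_less_b by simp
  \<comment> \<open>\<open>D\<close> is finite: its elements are multiples of
    \<open>1 / b ^ i\<close> between 0 and the chosen \<open>y\<close>.\<close>
  have "D \<subseteq> (\<lambda>u. of_int u / of_int b ^ i) ` {0..\<lfloor>y * of_int b ^ i\<rfloor>}"
  proof
    fix d assume d: "d \<in> D"
    then obtain u where u: "d * of_int b ^ i = of_int u" by (auto simp: D_def elim: Ints_cases)
    have "0 \<le> d" "0 \<le> y - d" using d y M_nonneg[of d] M_nonneg[of "y - d"] by (auto simp: D_def)
    then have "0 \<le> d * of_int b ^ i" "d * of_int b ^ i \<le> y * of_int b ^ i"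
      using bpos by (simp_all add: mult_right_mono)
    then have "u \<in> {0..\<lfloor>y * of_int b ^ i\<rfloor>}" unfolding u by (simp add: le_floor_iff)
    moreover have "d = of_int u / of_int b ^ i" using u bpos by (simp add: nonzero_eq_divide_eq b_nz del: of_int_eq_0_iff)
    ultimately show "d \<in> (\<lambda>u. of_int u / of_int b ^ i) ` {0..\<lfloor>y * of_int b ^ i\<rfloor>}" by blast
  qed
  then have fin: "finite D" by (rule finite_subset) simp
  have "0 \<in> D" using assms by (auto simp: D_def puiseux_monoid.zero)
  then have Max: "Max D \<in> D" using fin Max_in by blast
  show thesis
  proof (rule that[of "Max D"])
    fix e assume e: "e \<in> M" "\<And>x. x \<in> A \<Longrightarrow> x - Max D - e \<in> M"
    show "e = 0"
    proof (rule ccontr)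
      assume "e \<noteq> 0"
      then obtain k where k: "e - q ^ k \<in> M" using e M_diff_gen by blast
      have qk: "x - Max D - q ^ k \<in> M" if "x \<in> A" for x
        using puiseux_monoid.add[OF e(2)[OF that] k] by (simp add: algebra_simps)
      \<comment> \<open>The generator must have a denominator dividing \<open>b ^ i\<close>: for
        \<open>k \<le> i\<close> it is \<open>q ^ k\<close> itself, otherwise \<open>q ^ k\<close>
        is exchanged for \<open>q ^ i\<close>.\<close>
      have "x - Max D - q ^ min i k \<in> M" if "x \<in> A" for x
      proof (cases "k \<le> i")
        case False
        have "(x - Max D) * of_int b ^ i \<in> \<int>"
          using i[OF that] Max by (auto simp: D_def left_diff_distrib)
        then have "x - Max D - q ^ i \<in> M" using M_diff_gen_mono[OF qk[OF that]] False by simp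
        then show ?thesis using False by (simp add: min_def)
      qed (use qk that in \<open>simp add: min_def\<close>)
      moreover have "(Max D + q ^ min i k) * of_int b ^ i \<in> \<int>"
        using Max Ints_mult_b[OF q_pow_Ints, of "min i k" i] by (auto simp: D_def distrib_right)
      ultimately have "Max D + q ^ min i k \<in> D"
        using Max by (auto simp: D_def diff_diff_eq intro: puiseux_monoid.intros)
      then have "Max D + q ^ min i k \<le> Max D" by (rule Max_ge[OF fin])
      then show False using zero_less_power[OF q_pos, of "min i k"] by simp
    qed
  qed (use Max in \<open>auto simp: D_def\<close>)
qed

section \<open>Powers of the ideal generated by a\<close>

text \<open>The fractional ideal generated by a^j in the ring of integers with b inverted.\<close>
definition a_ideal :: "nat \<Rightarrow> rat set" where
  "a_ideal j = {x. \<exists>n u. x * of_int b ^ n = of_int (a ^ j * u)}"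

lemma a_ideal_add: "x \<in> a_ideal j \<Longrightarrow> y \<in> a_ideal j \<Longrightarrow> x + y \<in> a_ideal j"
proof -
  assume "x \<in> a_ideal j" "y \<in> a_ideal j"
  then obtain n u m v where "x * of_int b ^ n = of_int (a ^ j * u)"
    "y * of_int b ^ m = of_int (a ^ j * v)" by (auto simp: a_ideal_def)
  moreover have "(x + y) * of_int b ^ (n + m)
      = (x * of_int b ^ n) * of_int b ^ m + (y * of_int b ^ m) * of_int b ^ n"
    by (simp add: algebra_simps power_add)
  ultimately have "(x + y) * of_int b ^ (n + m) = of_int (a ^ j * (u * b ^ m + v * b ^ n))"
    by (simp add: algebra_simps)
  then show ?thesis unfolding a_ideal_def by blast
qed

lemma a_ideal_uminus: "x \<in> a_ideal j \<Longrightarrow> - x \<in> a_ideal j"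
proof -
  assume "x \<in> a_ideal j"
  then obtain n u where "x * of_int b ^ n = of_int (a ^ j * u)" by (auto simp: a_ideal_def)
  then have "- x * of_int b ^ n = of_int (a ^ j * - u)" by simp
  then show ?thesis unfolding a_ideal_def by blast
qed

text \<open>Since elements of \<open>M\<close> are nonnegative, the summands of an element below
  \<open>q ^ j\<close> are also below \<open>q ^ j\<close>, and a generator is below
  \<open>q ^ j\<close> only if its index is at least \<open>Suc j\<close>.\<close>

lemma M_small: "x \<in> M \<Longrightarrow> x < q ^ j \<Longrightarrow> x \<in> a_ideal (Suc j)"
proof (induction rule: puiseux_monoid.induct)
  case zero
  have "0 * of_int b ^ 0 = (of_int (a ^ Suc j * 0) :: rat)" by simp
  then show ?case unfolding a_ideal_def by blast
next
  case (gen n)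
  then have "j < n" using q_pos q_less_1 by (meson not_less order_less_le power_decreasing)
  then have "a ^ n = a ^ Suc j * a ^ (n - Suc j)" by (simp flip: power_add power_Suc)
  then have "q ^ n * of_int b ^ n = of_int (a ^ Suc j * a ^ (n - Suc j))"
    unfolding q_pow_mult by (metis of_int_power)
  then show ?case unfolding a_ideal_def by blast
next
  case (add x y)
  then show ?case using M_nonneg[of x] M_nonneg[of y] by (auto intro: a_ideal_add)
qed

lemma coprime_a_pow_b_pow: "coprime (a ^ j) (b ^ n)"
  using coprime by simp

text \<open>The powers of the ideal intersect in 0: as \<open>a\<close> is coprime to
  \<open>b\<close>, membership of \<open>r / t\<close> makes \<open>a ^ j\<close> divide the nonzero
  integer \<open>r\<close>, which bounds \<open>j\<close>.\<close>

lemma eventually_notin_a_ideal: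
  assumes "z \<noteq> 0"
  shows "eventually (\<lambda>j. z \<notin> a_ideal j) sequentially"
proof -
  obtain r t where rt: "quotient_of z = (r, t)" by (cases "quotient_of z")
  then have t: "t > 0" and z: "z = of_int r / of_int t"
    by (auto simp: quotient_of_denom_pos quotient_of_div)
  have r: "r \<noteq> 0" using z assms by auto
  \<comment> \<open>A divisor \<open>a ^ j\<close> of \<open>r\<close> would be at most
    \<open>\<bar>r\<bar> \<le> j\<close>, while \<open>a ^ j \<ge> 2 ^ j > j\<close>.\<close>
  have "z \<notin> a_ideal j" if j: "nat \<bar>r\<bar> \<le> j" for j
  proof
    assume "z \<in> a_ideal j"
    then obtain n u where "z * of_int b ^ n = of_int (a ^ j * u)" by (auto simp: a_ideal_def)
    then have "of_int (r * b ^ n) = (of_int (a ^ j * (u * t)) :: rat)"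
      using t by (simp add: z field_simps)
    then have "r * b ^ n = a ^ j * (u * t)" by (simp only: of_int_eq_iff)
    then have "a ^ j dvd r"
      using coprime_a_pow_b_pow by (metis coprime_dvd_mult_left_iff dvd_triv_left)
    then have "a ^ j \<le> \<bar>r\<bar>" using r by (simp add: dvd_imp_le_int zdvd_imp_le)
    moreover have "2 ^ j \<le> a ^ j" using a2 by (simp add: power_mono)
    moreover have "int j < 2 ^ j" by (rule of_nat_less_two_power)
    ultimately show False using j by linarith
  qed
  then show ?thesis by (rule eventually_sequentiallyI)
qed

text \<open>Cancelling \<open>a ^ n\<close> would leave \<open>a\<close> dividing a power of
  \<open>b\<close>, impossible for \<open>a \<ge> 2\<close> coprime to \<open>b\<close>.\<close>

lemma gen_notin_a_ideal: "q ^ n \<notin> a_ideal (Suc n)"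
proof
  assume "q ^ n \<in> a_ideal (Suc n)"
  then obtain m u where "q ^ n * of_int b ^ m = of_int (a ^ Suc n * u)"
    by (auto simp: a_ideal_def)
  then have "(q ^ n * of_int b ^ n) * of_int b ^ m = of_int (a ^ Suc n * u * b ^ n)"
    by (simp add: mult_ac)
  then have "of_int (a ^ n * b ^ m) = (of_int (a ^ n * (a * u * b ^ n)) :: rat)"
    unfolding q_pow_mult by (simp add: mult_ac)
  then have "a ^ n * b ^ m = a ^ n * (a * u * b ^ n)" by (simp only: of_int_eq_iff)
  then have "b ^ m = a * u * b ^ n" using a2 by simp
  then have "a dvd b ^ m" by simp
  moreover have "coprime a (b ^ m)" using coprime by simp
  ultimately have "is_unit a" using coprime_absorb_left by blast
  then show False using a2 by simp
qed

text \<open>Two nonzero summands would both be below \<open>q ^ n\<close>, hence in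
  \<open>a_ideal (Suc n)\<close>, which is closed under addition and misses
  \<open>q ^ n\<close>.\<close>

lemma gen_atom:
  assumes "s \<in> M" "t \<in> M" "s + t = q ^ n"
  shows "s = 0 \<or> t = 0"
proof (rule ccontr)
  assume "\<not> ?thesis"
  then have "s < q ^ n" "t < q ^ n" using M_nonneg assms
    by (metis add.commute less_add_same_cancel1 order_less_le)+
  then have "s + t \<in> a_ideal (Suc n)" using M_small assms a_ideal_add by blast
  then show False using gen_notin_a_ideal assms by simp
qed

section \<open>The monoid algebra\<close>

abbreviation R :: "(rat \<Rightarrow>\<^sub>0 rat) set" where "R \<equiv> monoid_algebra M"

lemma R_mult: "f \<in> R \<Longrightarrow> g \<in> R \<Longrightarrow> f * g \<in> R"
  using keys_mult[of f g] by (fastforce simp: monoid_algebra_def intro: puiseux_monoid.add)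

lemma single_in_R: "m \<in> M \<Longrightarrow> single m c \<in> R"
  by (simp add: monoid_algebra_def)

lemma Max_keys_in_M: "f \<in> R \<Longrightarrow> f \<noteq> 0 \<Longrightarrow> Max (keys f) \<in> M"
  using Max_in[of "keys f"] by (auto simp: monoid_algebra_def)

text \<open>A divisor of 1 is a monomial. The degrees of a unit and its inverse add up to 0 and are
  nonnegative, so both are 0.\<close>

lemma unit_in_R_iff: "unit_in R u \<longleftrightarrow> (\<exists>c. c \<noteq> 0 \<and> u = single 0 c)"
proof
  assume "unit_in R u"
  then obtain v where uv: "u \<in> R" "v \<in> R" "u * v = 1" by (auto simp: unit_in_def)
  then obtain s c where u: "u = single s c"
    using single_factor[of u v 0 1] by (auto simp: single_one)
  have nz: "u \<noteq> 0" "v \<noteq> 0" using uv by auto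
  then have c: "c \<noteq> 0" using u by auto
  have "Max (keys u) + Max (keys v) = 0"
    using Max_keys_mult(2)[OF nz] uv(3) by simp
  moreover have "0 \<le> Max (keys u)" "0 \<le> Max (keys v)"
    using Max_keys_in_M M_nonneg uv nz by auto
  ultimately have "Max (keys u) = 0" by simp
  then have "s = 0" using u c by simp
  then show "\<exists>c. c \<noteq> 0 \<and> u = single 0 c" using u c by blast
next
  assume "\<exists>c. c \<noteq> 0 \<and> u = single 0 c"
  then obtain c where "c \<noteq> 0" "u = single 0 c" by blast
  then have "u * single 0 (inverse c) = 1" by (simp add: mult_single flip: single_one)
  then show "unit_in R u"
    using \<open>u = single 0 c\<close> single_in_R puiseux_monoid.zero unfolding unit_in_def by blast
qed

text \<open>Factors of a monomial are monomials, so a factorization splits \<open>q ^ n\<close> in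
  \<open>M\<close>. By \<open>gen_atom\<close> one of the two exponents is 0, and that factor is a
  constant.\<close>

lemma irreducible_gen: "irreducible_in R (single (q ^ n) 1)"
  unfolding irreducible_in_def
proof (intro conjI ballI impI)
  show "single (q ^ n) 1 \<in> R" by (simp add: single_in_R puiseux_monoid.gen)
  show "single (q ^ n) (1::rat) \<noteq> 0" by (metis lookup_single_eq lookup_zero zero_neq_one)
  show "\<not> unit_in R (single (q ^ n) 1)"
  proof
    assume "unit_in R (single (q ^ n) 1)"
    then obtain c where "single (q ^ n) 1 = single 0 c" "c \<noteq> (0::rat)"
      unfolding unit_in_R_iff by auto
    then have "{q ^ n} = {0}" by (metis keys_single zero_neq_one)
    then show False using q_pos by simp
  qed
  fix f g assume fg: "f \<in> R" "g \<in> R" "single (q ^ n) 1 = f * g"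
  obtain s c t d where f: "f = single s c" and g: "g = single t d"
    using single_factor[of f g] single_factor[of g f] fg(3) by (metis mult.commute zero_neq_one)
  have eq: "single (q ^ n) 1 = single (s + t) (c * d)"
    using fg(3) by (simp add: f g mult_single)
  have cd: "c * d \<noteq> 0" using eq by (metis lookup_single_eq lookup_zero single_zero zero_neq_one)
  then have "{q ^ n} = {s + t}" using eq by (metis keys_single zero_neq_one)
  then have st: "s + t = q ^ n" by simp
  moreover have "s \<in> M" "t \<in> M" using fg cd by (auto simp: f g monoid_algebra_def)
  ultimately have "s = 0 \<or> t = 0" using gen_atom by blast
  then show "unit_in R f \<or> unit_in R g"
    unfolding unit_in_R_iff f g using cd by auto
qed

section \<open>Factorization up to constants\<close>

text \<open>The constant \<open>c\<close> stands apart and \<open>xs\<close> may be empty, so that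
  units are included and products need no case distinction.\<close>

definition factorable :: "(rat \<Rightarrow>\<^sub>0 rat) \<Rightarrow> bool" where
  "factorable f \<longleftrightarrow> (\<exists>c xs. c \<noteq> 0 \<and> (\<forall>x\<in>set xs. irreducible_in R x) \<and> f = single 0 c * prod_list xs)"

lemma factorable_mult: "factorable f \<Longrightarrow> factorable g \<Longrightarrow> factorable (f * g)"
proof -
  assume "factorable f" "factorable g"
  then obtain c xs d ys where cd: "c \<noteq> 0" "\<forall>x\<in>set xs. irreducible_in R x" "f = single 0 c * prod_list xs"
    "d \<noteq> 0" "\<forall>x\<in>set ys. irreducible_in R x" "g = single 0 d * prod_list ys"
    unfolding factorable_def by blast
  have "f * g = (single 0 c * single 0 d) * prod_list (xs @ ys)" using cd by (simp add: mult_ac)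
  also have "single 0 c * single 0 d = single 0 (c * d)" by (simp add: mult_single)
  finally show ?thesis using cd unfolding factorable_def
    by (intro exI[of _ "c * d"] exI[of _ "xs @ ys"]) auto
qed

lemma factorable_irreducible: "irreducible_in R f \<Longrightarrow> factorable f"
  unfolding factorable_def by (intro exI[of _ 1] exI[of _ "[f]"]) simp

lemma factorable_const: "c \<noteq> 0 \<Longrightarrow> factorable (single 0 c)"
  unfolding factorable_def by (intro exI[of _ c] exI[of _ "[]"]) simp

lemma factorable_single: "m \<in> M \<Longrightarrow> c \<noteq> 0 \<Longrightarrow> factorable (single m c)"
proof -
  have "m \<in> M \<Longrightarrow> factorable (single m 1)"
  proof (induction rule: puiseux_monoid.induct)
    case zero
    show ?case by (rule factorable_const) simp
  next
    case (gen n)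
    show ?case by (rule factorable_irreducible[OF irreducible_gen])
  next
    case (add x y)
    then show ?case using factorable_mult[OF add.IH] by (simp add: mult_single)
  qed
  moreover assume "m \<in> M" "c \<noteq> 0"
  ultimately show ?thesis using factorable_mult[OF factorable_const, of c "single m 1"]
    by (simp add: mult_single)
qed

text \<open>Lets the constant in \<open>factorable\<close> be absorbed into an irreducible
  factor.\<close>

lemma irreducible_const_mult:
  assumes "irreducible_in R x" "c \<noteq> 0"
  shows "irreducible_in R (single 0 c * x)"
proof -
  have u: "unit_in R (single 0 c)" and "single 0 c \<in> R" "single 0 (inverse c) \<in> R"
    using assms unit_in_R_iff single_in_R puiseux_monoid.zero by auto
  have inv: "single 0 (inverse c) * single 0 c = (1 :: rat \<Rightarrow>\<^sub>0 rat)" "single 0 (inverse c) \<noteq> 0" "single 0 c \<noteq> 0"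
    using assms by (auto simp: mult_single simp flip: single_one)
      (metis lookup_single_eq lookup_zero inverse_nonzero_iff_nonzero)+
  have cancel: "unit_in R y" if u: "unit_in R (single 0 d * y)" and "y \<in> R" for y d
  proof -
    obtain v where v: "v \<in> R" "single 0 d * y * v = 1"
      using u unfolding unit_in_def by blast
    have "single 0 d * v \<in> R" using v(1) by (simp add: R_mult single_in_R puiseux_monoid.zero)
    moreover have "y * (single 0 d * v) = 1" using v(2) by (simp add: mult_ac)
    ultimately show ?thesis using \<open>y \<in> R\<close> unfolding unit_in_def by blast
  qed
  show ?thesis
    unfolding irreducible_in_def
  proof (intro conjI ballI impI)
    show "single 0 c * x \<in> R" using assms \<open>single 0 c \<in> R\<close> by (auto simp: irreducible_in_def R_mult)
    show "single 0 c * x \<noteq> 0" using assms inv by (auto simp: irreducible_in_def)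
    show "\<not> unit_in R (single 0 c * x)" using assms cancel by (auto simp: irreducible_in_def)
    fix f g assume fg: "f \<in> R" "g \<in> R" "single 0 c * x = f * g"
    \<comment> \<open>The constant is moved into the first factor, so that the irreducibility of
      \<open>x\<close> applies.\<close>
    have "x = single 0 (inverse c) * single 0 c * x" using inv by simp
    also have "\<dots> = (single 0 (inverse c) * f) * g" using fg by (simp add: mult.assoc)
    finally have "unit_in R (single 0 (inverse c) * f) \<or> unit_in R g"
      using assms fg R_mult \<open>single 0 (inverse c) \<in> R\<close> unfolding irreducible_in_def by blast
    then show "unit_in R f \<or> unit_in R g" using cancel fg assms by auto
  qed
qed

lemma factorable_nonunit:
  assumes "factorable f" "\<not> unit_in R f"
  shows "\<exists>xs. xs \<noteq> [] \<and> (\<forall>x\<in>set xs. irreducible_in R x) \<and> f = prod_list xs"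
proof -
  obtain c xs where c: "c \<noteq> 0" "\<forall>x\<in>set xs. irreducible_in R x" "f = single 0 c * prod_list xs"
    using assms unfolding factorable_def by blast
  show ?thesis
  proof (cases xs)
    case Nil
    then have "f = single 0 c" using c by simp
    then show ?thesis using c(1) assms(2) unit_in_R_iff by blast
  next
    case (Cons y ys)
    then show ?thesis using c irreducible_const_mult
      by (intro exI[of _ "(single 0 c * y) # ys"]) (auto simp: mult.assoc)
  qed
qed

section \<open>Degree bound and termination of factorizations\<close>

text \<open>The bound depends on \<open>f\<close> alone. If all exponents of \<open>g\<close> were
  below \<open>q ^ J\<close> for a large \<open>J\<close>, they would lie in an additive group
  modulo which the exponents of \<open>f\<close> are incongruent, and \<open>g\<close> would be a
  monomial.\<close>

lemma nonmonomial_factor_degree: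
  assumes "f \<noteq> 0"
  obtains \<epsilon> where "0 < \<epsilon>"
    "\<And>g h. g \<in> R \<Longrightarrow> f = g * h \<Longrightarrow> (\<And>s c. g \<noteq> single s c) \<Longrightarrow> \<epsilon> \<le> Max (keys g)"
proof -
  \<comment> \<open>\<open>Z\<close> collects the finitely many nonzero differences of exponents of
    \<open>f\<close>; a large power of the ideal avoids them all.\<close>
  define Z where "Z = {z \<in> (\<lambda>(x, y). x - y) ` (keys f \<times> keys f). z \<noteq> 0}"
  have "finite Z" by (simp add: Z_def)
  then have "eventually (\<lambda>j. \<forall>z\<in>Z. z \<notin> a_ideal j) sequentially"
    by (rule eventually_ball_finite) (auto simp: Z_def intro!: eventually_notin_a_ideal)
  then obtain J where "\<forall>j\<ge>J. \<forall>z\<in>Z. z \<notin> a_ideal j" by (auto simp: eventually_sequentially)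
  \<comment> \<open>The shift to \<open>Suc J\<close> matches \<open>M_small\<close>, which puts
    exponents below \<open>q ^ J\<close> into \<open>a_ideal (Suc J)\<close>.\<close>
  then have J: "\<forall>z\<in>Z. z \<notin> a_ideal (Suc J)" by simp
  show thesis
  proof (rule that[of "q ^ J"])
    show "0 < q ^ J" using q_pos by simp
    fix g h assume g: "g \<in> R" and f: "f = g * h" and nm: "\<And>s c. g \<noteq> single s c"
    show "q ^ J \<le> Max (keys g)"
    proof (rule ccontr)
      assume less: "\<not> ?thesis"
      have "keys g \<subseteq> a_ideal (Suc J)"
      proof
        fix x assume x: "x \<in> keys g"
        then have "x < q ^ J" using less by (meson Max_ge finite_keys le_less_trans not_le)
        then show "x \<in> a_ideal (Suc J)" using M_small x g by (auto simp: monoid_algebra_def)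
      qed
      moreover have "x = y" if "x \<in> keys (g * h)" "y \<in> keys (g * h)" "x - y \<in> a_ideal (Suc J)" for x y
        using that J by (force simp: Z_def f)
      ultimately have "\<exists>t d. g = single t d"
        using single_factor_of_incongruent_keys[of g h "a_ideal (Suc J)"]
          a_ideal_add a_ideal_uminus assms f by blast
      then show False using nm by blast
    qed
  qed
qed

text \<open>With \<open>d\<close> a maximal common divisor of the exponents of \<open>f\<close>, a
  monomial factor of \<open>g\<close> with exponent \<open>e\<close> makes \<open>d + e\<close> a
  common divisor too, forcing \<open>e = 0\<close>.\<close>

lemma extract_monomial:
  assumes "f \<in> R" "f \<noteq> 0"
  obtains d g where "d \<in> M" "g \<in> R" "f = single d 1 * g"
    "\<And>e c h. g = single e c * h \<Longrightarrow> e \<in> M \<Longrightarrow> h \<in> R \<Longrightarrow> e = 0"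
proof -
  obtain d where d: "d \<in> M" "\<And>x. x \<in> keys f \<Longrightarrow> x - d \<in> M"
    "\<And>e. e \<in> M \<Longrightarrow> (\<And>x. x \<in> keys f \<Longrightarrow> x - d - e \<in> M) \<Longrightarrow> e = 0"
    using maximal_common_divisor[of "keys f"] assms by (auto simp: monoid_algebra_def)
  \<comment> \<open>The exponent \<open>- d\<close> may lie outside \<open>M\<close>: the product is
    taken in the group algebra, and the choice of \<open>d\<close> puts it back into
    \<open>R\<close>.\<close>
  define g where "g = single (- d) 1 * f"
  have f: "f = single d 1 * g"
    by (simp add: g_def mult_single flip: mult.assoc)
  show thesis
  proof (rule that[OF d(1) _ f])
    show "g \<in> R" unfolding monoid_algebra_def
    proof (clarify)
      fix x assume "x \<in> keys g"
      then have "x + d \<in> keys f" by (simp add: g_def in_keys_iff lookup_single_mult)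
      then show "x \<in> M" using d(2)[of "x + d"] by simp
    qed
    fix e c h assume g: "g = single e c * h" and "e \<in> M" and h: "h \<in> R"
    have "x - d - e \<in> M" if "x \<in> keys f" for x
    proof -
      have "f = single (d + e) c * h" by (simp add: f g mult_single flip: mult.assoc)
      then have "x - (d + e) \<in> keys h" using that by (simp add: in_keys_iff lookup_single_mult)
      then show ?thesis using h by (auto simp: monoid_algebra_def diff_diff_eq)
    qed
    then show "e = 0" using d(3) \<open>e \<in> M\<close> by blast
  qed
qed

text \<open>Once a maximal monomial is removed, each splitting into two nonunits lowers the degree
  of both parts by at least \<open>\<epsilon>\<close>, so splitting terminates.\<close>

lemma factorable_all:
  assumes f: "f \<in> R" "f \<noteq> 0"
  shows "factorable f"
proof (rule nonmonomial_factor_degree[OF f(2)])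
  fix \<epsilon> :: rat
  assume \<epsilon>: "0 < \<epsilon>"
    "\<And>g h. g \<in> R \<Longrightarrow> f = g * h \<Longrightarrow> (\<And>s c. g \<noteq> single s c) \<Longrightarrow> \<epsilon> \<le> Max (keys g)"
  \<comment> \<open>The induction runs over factors \<open>g\<close> of the fixed \<open>f\<close>,
    so that the same \<open>\<epsilon>\<close> serves throughout; \<open>n\<close> bounds the degree
    in units of \<open>\<epsilon>\<close>.\<close>
  have "factorable g" if "g \<in> R" "f = g * h" "Max (keys g) < of_nat n * \<epsilon>" for g h n
    using that
  proof (induction n arbitrary: g h)
    case 0
    then have "g \<noteq> 0" using f by auto
    then have "0 \<le> Max (keys g)" using Max_keys_in_M M_nonneg 0 by blast
    then show ?case using 0 by simp
  next
    case (Suc n)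
    have "g \<noteq> 0" using Suc f by auto
    then obtain d g' where g': "d \<in> M" "g' \<in> R" "g = single d 1 * g'"
      "\<And>e c h. g' = single e c * h \<Longrightarrow> e \<in> M \<Longrightarrow> h \<in> R \<Longrightarrow> e = 0"
      using extract_monomial Suc.prems by metis
    have g'nz: "g' \<noteq> 0" using g' \<open>g \<noteq> 0\<close> by auto
    have sd: "single d (1::rat) \<noteq> 0" by (metis lookup_single_eq lookup_zero zero_neq_one)
    have "Max (keys g) = d + Max (keys g')" using Max_keys_mult(2)[OF sd g'nz] g' by simp
    then have deg: "Max (keys g') < of_nat (Suc n) * \<epsilon>" using M_nonneg[OF g'(1)] Suc.prems by simp
    \<comment> \<open>A monomial factor of \<open>g'\<close> has exponent 0 by the choice of
      \<open>d\<close>, so nonunit factors of \<open>g'\<close> are not monomials.\<close>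
    have const: "unit_in R u" if "u \<in> R" "v \<in> R" "g' = u * v" "u = single e c" for u v e c
    proof -
      have "c \<noteq> 0" using that g'nz by auto
      then have "e \<in> M" using that by (auto simp: monoid_algebra_def)
      then have "e = 0" using g'(4) that by blast
      then show ?thesis using that \<open>c \<noteq> 0\<close> unit_in_R_iff by blast
    qed
    have "factorable g'"
    proof (cases "unit_in R g' \<or> irreducible_in R g'")
      case True
      then show ?thesis using factorable_irreducible factorable_const unit_in_R_iff by auto
    next
      case False
      then obtain u v where uv: "u \<in> R" "v \<in> R" "g' = u * v" "\<not> unit_in R u" "\<not> unit_in R v"
        using g'nz g'(2) unfolding irreducible_in_def by blast
      \<comment> \<open>Both \<open>u\<close> and \<open>v\<close> divide \<open>f\<close> as well,
        so the lower bound on degrees applies to them.\<close>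
      have fu: "f = u * (v * single d 1 * h)" and fv: "f = v * (u * single d 1 * h)"
        using Suc.prems(2) g'(3) uv(3) by (simp_all add: mult_ac)
      have "\<epsilon> \<le> Max (keys u)" using \<epsilon>(2)[OF uv(1) fu] const uv by blast
      moreover have "\<epsilon> \<le> Max (keys v)"
        using \<epsilon>(2)[OF uv(2) fv] const[of v u] uv by (metis mult.commute)
      moreover have "Max (keys g') = Max (keys u) + Max (keys v)"
        using Max_keys_mult(2)[of u v] uv g'nz by auto
      \<comment> \<open>Each of the two degrees is that of \<open>g'\<close> minus the other, which
        is at least \<open>\<epsilon>\<close>.\<close>
      ultimately have "Max (keys u) < of_nat n * \<epsilon>" "Max (keys v) < of_nat n * \<epsilon>"
        using deg by (simp_all add: algebra_simps)
      then have "factorable u" "factorable v" using Suc.IH uv fu fv by blast+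
      then show ?thesis using factorable_mult uv by simp
    qed
    then show ?case using factorable_mult factorable_single g' by simp
  qed
  moreover obtain n where "Max (keys f) < of_nat n * \<epsilon>"
    using ex_less_of_nat_mult[OF \<epsilon>(1)] by blast
  ultimately show ?thesis using f(1) by (metis mult.right_neutral)
qed

lemma atomic: "atomic_domain R"
  unfolding atomic_domain_def using factorable_all factorable_nonunit by blast

end

theorem theorem5p2:
  fixes q :: rat
  assumes "0 < q" and "q < 1"
    and "\<forall>n::nat. n \<ge> 2 \<longrightarrow> q \<noteq> 1 / of_nat n"
    and "odd (snd (quotient_of q))"
  shows "atomic_domain (monoid_algebra (puiseux_monoid q) :: (rat \<Rightarrow>\<^sub>0 rat) set)"
proof -
  obtain a b where ab: "quotient_of q = (a, b)" by (cases "quotient_of q")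
  then have q: "q = of_int a / of_int b" and b: "0 < b" and cop: "coprime a b"
    by (auto simp: quotient_of_div quotient_of_denom_pos quotient_of_coprime)
  have "0 < a" "a < b" using assms(1,2) b by (simp_all add: q field_simps)
  \<comment> \<open>Numerator 1 would give \<open>q = 1 / b\<close> with \<open>b \<ge> 2\<close>,
    which is excluded; together with \<open>0 < a\<close> this yields
    \<open>2 \<le> a\<close>.\<close>
  moreover have "a \<noteq> 1"
  proof
    assume "a = 1"
    then have "q = 1 / of_nat (nat b)" "2 \<le> nat b" using b \<open>a < b\<close> by (simp_all add: q)
    then show False using assms(3) by blast
  qed
  ultimately interpret exponential_puiseux a b q by unfold_locales (use q cop in auto)
  show ?thesis by (rule atomic)
qed

end
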